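(* For integers $n,l\ge 1$ let $X_n^{(l)}$ denote the number of blocks of size $l$ in a uniformly random non-crossing partition of $[n]=\{1,\dots,n\}$. (1) For all $l\ge 1$ and $n\ge 1$ with $2n>l$, $$\mathbb{E}X_n^{(l)}=\frac{n}{2^{l+1}}\prod_{j=0}^{l}\Big(1+\frac{2-j}{2n-j}\Big).$$ (2) For every fixed $l\ge 1$, as $n\to\infty$, $$\mathrm{Var}\,X_n^{(l)}=\frac{n}{2^{2l+3}}\Big[2^{l+2}-(l-1)^2-2\Big]+O(1),$$ where the constant implied in the $O$-term may depend on $l$. (3) For all fixed $k,l\ge 1$ with $k\ne l$, as $n\to\infty$, $$\mathrm{Cov}\big(X_n^{(k)},X_n^{(l)}\big)=-\frac{n}{2^{k+l+3}}\Big[2+(k-1)(l-1)\Big]+O(1),$$ where the constant implied in the $O$-term may depend on $k$ and $l$. Here $X_n^{(k)}$ and $X_n^{(l)}$ are computed from the same random partition.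
   Context: A partition of $[n]=\{1,\dots,n\}$ into (nonempty) subsets, called blocks, is non-crossing if there are no elements $a<b<c<d$ such that $a$ and $c$ lie in one block and $b$ and $d$ lie in a different block. A random non-crossing partition of $[n]$ is one chosen uniformly from the finite set of all non-crossing partitions of $[n]$. The size (or length) of a block is its number of elements. *)

theory Defs
  imports
    "HOL-Probability.Probability"
    "HOL-Library.Disjoint_Sets"
    "HOL-Library.Landau_Symbols"
begin

definition noncrossing :: "nat set set \<Rightarrow> bool" where
  "noncrossing P \<longleftrightarrow>
     \<not> (\<exists>A\<in>P. \<exists>B\<in>P. A \<noteq> B \<and>
          (\<exists>a b c d. a < b \<and> b < c \<and> c < d \<and> a \<in> A \<and> c \<in> A \<and> b \<in> B \<and> d \<in> B))"

definition noncrossing_partitions :: "nat \<Rightarrow> nat set set set" where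
  "noncrossing_partitions n = {P. partition_on {1..n} P \<and> noncrossing P}"

text \<open>
  The set of non-crossing partitions is finite and nonempty for every \<open>n\<close> (the lemmas below),
  so \<^const>\<open>pmf_of_set\<close> really denotes the uniform distribution on it.
\<close>

definition random_ncp :: "nat \<Rightarrow> nat set set pmf" where
  "random_ncp n = pmf_of_set (noncrossing_partitions n)"

definition num_blocks :: "nat \<Rightarrow> nat set set \<Rightarrow> real" where
  "num_blocks l P = real (card {B \<in> P. card B = l})"

definition pmf_covariance :: "'a pmf \<Rightarrow> ('a \<Rightarrow> real) \<Rightarrow> ('a \<Rightarrow> real) \<Rightarrow> real" where
  "pmf_covariance p X Y =
     measure_pmf.expectation p
       (\<lambda>x. (X x - measure_pmf.expectation p X) * (Y x - measure_pmf.expectation p Y))"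

lemma finite_noncrossing_partitions: "finite (noncrossing_partitions n)"
proof (rule finite_subset)
  show "noncrossing_partitions n \<subseteq> Pow (Pow {1..n})"
    by (auto simp: noncrossing_partitions_def partition_on_def)
qed simp

lemma noncrossing_partitions_nonempty: "noncrossing_partitions n \<noteq> {}"
proof -
  have "(\<lambda>i. {i}) ` {1..n} \<in> noncrossing_partitions n"
    by (auto simp: noncrossing_partitions_def noncrossing_def partition_on_def disjoint_def)
  then show ?thesis by blast
qed

end

theory Submission
  imports Defs
begin

text \<open>
  A non-crossing partition of \<open>[n]\<close> is read from left to right with a stack of pending elements.
  Whenever an element is the maximum of its block, that block consists of the most recent pending
  elements, because an older element cannot be taken past a newer one without a crossing. The
  partition is therefore determined by the word whose \<open>j\<close>-th letter is the size of the block
  with maximum \<open>j\<close> (or \<open>0\<close> if there is none), and the words that occur are those of length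
  \<open>n\<close> and sum \<open>n\<close> whose prefixes of length \<open>t\<close> have sum at most \<open>t\<close>
  (\<open>bij_betw_closing_word\<close>). Blocks of size \<open>l\<close> become letters equal to \<open>l\<close>.

  The prefix condition is removed by the cycle lemma (\<open>cycle_lemma\<close>): after prefixing a \<open>0\<close>,
  these words are the good members of the set of all sequences of \<open>n + 1\<close> natural numbers with
  sum \<open>n\<close>, and exactly one of the \<open>n + 1\<close> rotations of any such sequence is good. Since letter
  counts do not change under rotation, a sum over non-crossing partitions equals
  \<open>1 / (n + 1)\<close> times the same sum over unrestricted sequences
  (\<open>sum_noncrossing_partitions\<close>). There, marking a letter and deleting it
  (\<open>sum_weak_compositions_mark\<close>) reduces the first and second factorial moments to
  counting sequences. There are \<open>(2n choose n) / (n + 1)\<close> partitions; together they have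
  \<open>2n - l - 1 choose n - 1\<close> blocks of size \<open>l\<close>, and \<open>n * (2n - k - l - 2 choose n - 2)\<close> ordered
  pairs of distinct blocks with sizes \<open>k\<close> and \<open>l\<close>.

  Quotients of these binomial coefficients are finite products of linear fractions in \<open>n\<close>. The
  first moment is the claimed product exactly. For the second moments, each factor has the form
  \<open>1 + c / n + O(1 / n\<^sup>2)\<close>, and such expansions multiply by adding the coefficients \<open>c\<close>. In
  \<open>E(X Y) - E X * E Y\<close> the terms of order \<open>n\<^sup>2\<close> cancel and the coefficients \<open>c\<close> give the term of
  order \<open>n\<close>. For \<open>k = l\<close> the mean is added, because the factorial moment counts only pairs of
  distinct blocks.
\<close>

section \<open>Closing words of non-crossing partitions\<close>

text \<open>
  The configurations after reading the elements up to \<open>n\<close>: \<open>P\<close> holds the blocks that are already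
  complete, and the elements outside \<open>\<Union>P\<close> are pending. No pending element lies under a
  complete block, since its own block is to be completed later and would cross that block.
\<close>

definition partial_ncp :: "nat \<Rightarrow> nat set set set" where
  "partial_ncp n = {P. disjoint P \<and> {} \<notin> P \<and> \<Union>P \<subseteq> {1..n} \<and> noncrossing P \<and>
     (\<forall>A\<in>P. \<forall>a\<in>A. \<forall>b\<in>A. {a..b} \<subseteq> \<Union>P)}"

definition closing_word :: "nat \<Rightarrow> nat set set \<Rightarrow> nat list" where
  "closing_word n P = map (\<lambda>j. \<Sum>B | B \<in> P \<and> Max B = j. card B) [1..<Suc n]"

text \<open>
  A block closed at time \<open>t\<close> or before consists of elements read by then, so the letters up to
  place \<open>t\<close> account for at most \<open>t\<close> elements.
\<close>

definition ballot_words :: "nat \<Rightarrow> nat list set" where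
  "ballot_words n = {c. length c = n \<and> (\<forall>t\<le>n. sum_list (take t c) \<le> t)}"

text \<open>
  The top segments of the pending elements are the only candidates for the next block.
\<close>

definition top_segment :: "nat set \<Rightarrow> nat set \<Rightarrow> bool" where
  "top_segment A B \<longleftrightarrow> B \<subseteq> A \<and> (\<forall>x\<in>A - B. \<forall>b\<in>B. x < b)"

text \<open>
  Top segments of one set form a chain, so the size of a block determines the block.
\<close>

lemma top_segment_unique:
  assumes "finite A" "top_segment A B" "top_segment A C" "card B = card C"
  shows "B = C"
proof -
  have fin: "finite B" "finite C"
    using assms by (auto simp: top_segment_def intro: finite_subset)
  have "B \<subseteq> C \<or> C \<subseteq> B"
    using assms(2,3) unfolding top_segment_def by (metis DiffI less_asym subset_iff)
  then show ?thesis
    using fin assms(4) card_subset_eq by metis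
qed

lemma top_segment_exists:
  assumes "finite A" "s \<le> card A"
  shows "\<exists>B. top_segment A B \<and> card B = s"
  using assms(2)
proof (induction s)
  case 0
  then show ?case by (intro exI[of _ "{}"]) (auto simp: top_segment_def)
next
  case (Suc s)
  then obtain B where B: "top_segment A B" "card B = s" by auto
  have sub: "B \<subseteq> A" and finB: "finite B"
    using B assms(1) by (auto simp: top_segment_def intro: finite_subset)
  have ne: "A - B \<noteq> {}" using Suc.prems B(2) sub finB
    by (metis Diff_eq_empty_iff card_mono not_less_eq_eq)
  define m where "m = Max (A - B)"
  have m: "m \<in> A - B" "\<And>x. x \<in> A - B \<Longrightarrow> x \<le> m"
    using Max_in[OF _ ne] assms(1) by (auto simp: m_def)
  have "top_segment A (insert m B)"
    unfolding top_segment_def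
  proof (intro conjI ballI)
    show "insert m B \<subseteq> A" using m sub by auto
  next
    fix x b assume x: "x \<in> A - insert m B" and b: "b \<in> insert m B"
    show "x < b"
    proof (cases "b = m")
      case True
      have "x \<le> m" "x \<noteq> m" using x m(2) by auto
      then show ?thesis using True by auto
    next
      case False
      then show ?thesis using x b B(1) by (auto simp: top_segment_def)
    qed
  qed
  moreover have "card (insert m B) = Suc s" using m finB B(2) by auto
  ultimately show ?case by blast
qed

lemma finite_partial_ncp:
  assumes "P \<in> partial_ncp n"
  shows "finite P" and "finite (\<Union>P)" and "B \<in> P \<Longrightarrow> finite B" and "B \<in> P \<Longrightarrow> Max B \<in> B"
proof -
  have sub: "\<Union>P \<subseteq> {1..n}" and ne: "{} \<notin> P" using assms by (auto simp: partial_ncp_def)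
  show f: "finite (\<Union>P)" using sub finite_subset by blast
  then show "finite P" by (rule finite_UnionD)
  show fb: "finite B" if "B \<in> P" using that f by (meson Union_upper finite_subset)
  show "Max B \<in> B" if "B \<in> P" using that fb ne by (intro Max_in) auto
qed

lemma closing_word_Suc:
  "closing_word (Suc n) P = closing_word n P @ [sum card {B. B \<in> P \<and> Max B = Suc n}]"
  by (simp add: closing_word_def)

lemma closing_word_insert:
  assumes "finite P" "B \<notin> P" "Max B = Suc n"
  shows "closing_word n (insert B P) = closing_word n P"
  unfolding closing_word_def
proof (rule map_cong)
  fix j assume "j \<in> set [1..<Suc n]"
  then have "{A. A \<in> insert B P \<and> Max A = j} = {A. A \<in> P \<and> Max A = j}" using assms(3) by auto
  then show "(\<Sum>A | A \<in> insert B P \<and> Max A = j. card A) = (\<Sum>A | A \<in> P \<and> Max A = j. card A)"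
    by simp
qed simp

lemma partial_ncp_Max_le:
  assumes "P \<in> partial_ncp n" "B \<in> P"
  shows "Max B \<le> n"
  using finite_partial_ncp(4)[OF assms] assms by (auto simp: partial_ncp_def)

lemma closing_word_Suc_open:
  assumes "P \<in> partial_ncp n"
  shows "closing_word (Suc n) P = closing_word n P @ [0]"
proof -
  have "{B. B \<in> P \<and> Max B = Suc n} = {}" using partial_ncp_Max_le[OF assms] by fastforce
  then show ?thesis unfolding closing_word_Suc by (simp only: sum.empty)
qed

lemma closing_word_Suc_close:
  assumes P: "P \<in> partial_ncp n" and B: "B \<subseteq> {1..Suc n}" "Suc n \<in> B"
  shows "B \<notin> P" "closing_word (Suc n) (insert B P) = closing_word n P @ [card B]"
proof -
  have max: "Max B = Suc n" using B by (intro Max_eqI) (auto intro: finite_subset)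
  then show nin: "B \<notin> P" using partial_ncp_Max_le[OF P] by fastforce
  have "{A. A \<in> insert B P \<and> Max A = Suc n} = {B}"
    using partial_ncp_Max_le[OF P] max by fastforce
  then show "closing_word (Suc n) (insert B P) = closing_word n P @ [card B]"
    unfolding closing_word_Suc
    using closing_word_insert[OF finite_partial_ncp(1)[OF P] nin max] by simp
qed

lemma partial_ncp_mono: "P \<in> partial_ncp n \<Longrightarrow> P \<in> partial_ncp (Suc n)"
  by (auto simp: partial_ncp_def)

text \<open>
  A top segment of the pending elements can always be closed. If it crossed an older block, one
  of its elements would lie under that block, but pending elements never do. Everything between
  two of its elements is either used already or belongs to the segment.
\<close>

lemma partial_ncp_insert:
  assumes P: "P \<in> partial_ncp n" and B: "top_segment ({1..Suc n} - \<Union>P) B" and n: "Suc n \<in> B"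
  shows "insert B P \<in> partial_ncp (Suc n)"
proof -
  have Pp: "disjoint P" "{} \<notin> P" "\<Union>P \<subseteq> {1..n}" "noncrossing P"
    and cov: "\<And>A a b x. A \<in> P \<Longrightarrow> a \<in> A \<Longrightarrow> b \<in> A \<Longrightarrow> a \<le> x \<Longrightarrow> x \<le> b \<Longrightarrow> x \<in> \<Union>P"
    using P by (auto simp: partial_ncp_def subset_iff)
  have Bs: "B \<subseteq> {1..Suc n} - \<Union>P" and up: "\<And>x b. x \<in> {1..Suc n} - \<Union>P - B \<Longrightarrow> b \<in> B \<Longrightarrow> x < b"
    using B by (auto simp: top_segment_def)
  have "disjoint (insert B P)"
    using Pp(1) Bs by (auto simp: disjoint_def)
  moreover have "{} \<notin> insert B P" using Pp n by auto
  moreover have "\<Union>(insert B P) \<subseteq> {1..Suc n}" using Pp Bs by fastforce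
  moreover have "noncrossing (insert B P)"
    unfolding noncrossing_def
  proof (rule notI, elim bexE conjE exE)
    fix A C a b c d
    assume *: "A \<in> insert B P" "C \<in> insert B P" "A \<noteq> C" "a < b" "b < c" "c < d"
      "a \<in> A" "c \<in> A" "b \<in> C" "d \<in> C"
    consider "A = B" "C \<in> P" | "C = B" "A \<in> P" | "A \<in> P" "C \<in> P" using * by auto
    then show False
    proof cases
      case 1
      then show ?thesis using cov[of C b d c] * Bs by auto
    next
      case 2
      then show ?thesis using cov[of A a c b] * Bs by auto
    next
      case 3
      then show ?thesis using Pp(4) * unfolding noncrossing_def by blast
    qed
  qed
  moreover have "x \<in> \<Union>(insert B P)"
    if *: "A \<in> insert B P" "a \<in> A" "b \<in> A" "a \<le> x" "x \<le> b" for A a b x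
  proof (cases "A = B")
    case True
    have "a \<in> {1..Suc n}" "b \<in> {1..Suc n}" using True *(2,3) Bs by blast+
    then have "x \<in> {1..Suc n}" using *(4,5) by simp
    moreover have "\<not> x < a" using *(4) by simp
    ultimately show ?thesis using up[of x a] True *(2) by blast
  next
    case False
    then show ?thesis using * cov[of A a b x] by auto
  qed
  ultimately show ?thesis unfolding partial_ncp_def subset_iff by (simp; blast)
qed

lemma noncrossing_subset: "noncrossing P \<Longrightarrow> Q \<subseteq> P \<Longrightarrow> noncrossing Q"
  unfolding noncrossing_def by (meson subsetD)

text \<open>
  The converse of closing a top segment. An element of \<open>B\<close> under an older block would lead to a crossing
  because \<open>B\<close> also contains \<open>Suc n\<close>. Elements that stay pending are not under \<open>B\<close>, and since \<open>B\<close>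
  reaches up to \<open>Suc n\<close>, they precede all of \<open>B\<close>.
\<close>

lemma partial_ncp_remove:
  assumes P: "P \<in> partial_ncp (Suc n)" and B: "B \<in> P" "Suc n \<in> B"
  shows "P - {B} \<in> partial_ncp n" "top_segment ({1..Suc n} - \<Union>(P - {B})) B"
proof -
  have Pp: "disjoint P" "{} \<notin> P" "\<Union>P \<subseteq> {1..Suc n}" "noncrossing P"
    and cov: "\<And>A a b x. A \<in> P \<Longrightarrow> a \<in> A \<Longrightarrow> b \<in> A \<Longrightarrow> a \<le> x \<Longrightarrow> x \<le> b \<Longrightarrow> x \<in> \<Union>P"
    using P by (auto simp: partial_ncp_def subset_iff)
  have dis: "A \<inter> B = {}" if "A \<in> P" "A \<noteq> B" for A
    using that Pp(1) B by (auto simp: disjoint_def)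
  have "disjoint (P - {B})" using Pp(1) by (auto simp: disjoint_def)
  moreover have sub: "\<Union>(P - {B}) \<subseteq> {1..n}"
  proof
    fix x assume "x \<in> \<Union>(P - {B})"
    then obtain A where A: "A \<in> P" "A \<noteq> B" "x \<in> A" by auto
    then have "x \<in> {1..Suc n}" "x \<noteq> Suc n" using Pp(3) dis[of A] B(2) by auto
    then show "x \<in> {1..n}" by auto
  qed
  moreover have "noncrossing (P - {B})" using Pp(4) by (rule noncrossing_subset) blast
  moreover have "x \<in> \<Union>(P - {B})"
    if *: "A \<in> P" "A \<noteq> B" "a \<in> A" "b \<in> A" "a \<le> x" "x \<le> b" for A a b x
  proof -
    have x: "x \<in> \<Union>P" using cov[of A a b x] * by auto
    have "x \<notin> B"
    proof
      assume xB: "x \<in> B"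
      then have "a < x" "x < b" using * dis[of A] by (auto simp: le_less)
      moreover have "b < Suc n" using sub * by fastforce
      ultimately show False
        using Pp(4) * B xB unfolding noncrossing_def by blast
    qed
    then show ?thesis using x by auto
  qed
  moreover have "{} \<notin> P - {B}" using Pp(2) by blast
  ultimately show "P - {B} \<in> partial_ncp n"
    unfolding partial_ncp_def by (simp add: subset_iff) blast
  show "top_segment ({1..Suc n} - \<Union>(P - {B})) B"
    unfolding top_segment_def
  proof (intro conjI ballI)
    show "B \<subseteq> {1..Suc n} - \<Union>(P - {B})" using B Pp(3) dis by blast
  next
    fix x b assume x: "x \<in> {1..Suc n} - \<Union>(P - {B}) - B" and b: "b \<in> B"
    then have "x \<notin> \<Union>P" by auto
    then show "x < b" using cov[OF B(1) b B(2), of x] x by force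
  qed
qed

text \<open>
  Reading one more element either leaves it pending or closes a block with that element as maximum.
  All further facts on closing words follow by induction along this dichotomy.
\<close>

lemma partial_ncp_Suc_cases:
  assumes "P \<in> partial_ncp (Suc n)"
  obtains (opened) "P \<in> partial_ncp n"
    | (closed) Q B where "Q \<in> partial_ncp n" "top_segment ({1..Suc n} - \<Union>Q) B" "Suc n \<in> B"
        "P = insert B Q"
proof (cases "Suc n \<in> \<Union>P")
  case True
  then obtain B where "B \<in> P" "Suc n \<in> B" by auto
  then show ?thesis
    using partial_ncp_remove[OF assms] closed[of "P - {B}" B] by (auto simp: insert_absorb)
next
  case False
  have "\<Union>P \<subseteq> {1..n}"
  proof
    fix x assume "x \<in> \<Union>P"
    then have "x \<in> {1..Suc n}" "x \<noteq> Suc n" using assms False by (auto simp: partial_ncp_def)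
    then show "x \<in> {1..n}" by auto
  qed
  then show ?thesis using assms opened by (auto simp: partial_ncp_def)
qed

lemma sum_list_closing_word:
  assumes "P \<in> partial_ncp n"
  shows "sum_list (closing_word n P) = card (\<Union>P)"
  using assms
proof (induction n arbitrary: P)
  case 0
  then have "\<Union>P = {}" by (auto simp: partial_ncp_def)
  then have "card (\<Union>P) = 0" by (simp only: card.empty)
  then show ?case by (simp add: closing_word_def)
next
  case (Suc n)
  from Suc.prems show ?case
  proof (cases rule: partial_ncp_Suc_cases)
    case opened
    then show ?thesis using Suc.IH closing_word_Suc_open by simp
  next
    case (closed Q B)
    have B: "B \<subseteq> {1..Suc n}" "B \<inter> \<Union>Q = {}" using closed(2) by (auto simp: top_segment_def)
    have "card (\<Union>P) = card B + card (\<Union>Q)"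
      using B finite_partial_ncp(2)[OF closed(1)] closed(4)
      by (simp add: card_Un_disjoint finite_subset)
    then show ?thesis
      using closing_word_Suc_close(2)[OF closed(1) B(1) closed(3)] Suc.IH[OF closed(1)] closed(4)
      by simp
  qed
qed

lemma count_closing_word:
  assumes "P \<in> partial_ncp n" "l \<ge> 1"
  shows "count_list (closing_word n P) l = card {B \<in> P. card B = l}"
  using assms(1)
proof (induction n arbitrary: P)
  case 0
  then have "P = {}" by (auto simp: partial_ncp_def)
  then show ?case by (simp add: closing_word_def)
next
  case (Suc n)
  from Suc.prems show ?case
  proof (cases rule: partial_ncp_Suc_cases)
    case opened
    then show ?thesis using Suc.IH closing_word_Suc_open assms(2) by simp
  next
    case (closed Q B)
    have B: "B \<subseteq> {1..Suc n}" using closed(2) by (auto simp: top_segment_def)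
    note w = closing_word_Suc_close[OF closed(1) B closed(3)]
    have "{A \<in> insert B Q. card A = l} =
        (if card B = l then insert B {A \<in> Q. card A = l} else {A \<in> Q. card A = l})" by auto
    then show ?thesis
      using w Suc.IH[OF closed(1)] closed(4) finite_partial_ncp(1)[OF closed(1)] by simp
  qed
qed

lemma ballot_words_snoc:
  "c @ [s] \<in> ballot_words (Suc n) \<longleftrightarrow> c \<in> ballot_words n \<and> sum_list c + s \<le> Suc n"
proof -
  have "(\<forall>t\<le>Suc n. sum_list (take t (c @ [s])) \<le> t) \<longleftrightarrow>
      (\<forall>t\<le>n. sum_list (take t c) \<le> t) \<and> sum_list c + s \<le> Suc n" if "length c = n"
    using that by (auto simp: le_Suc_eq)
  then show ?thesis by (auto simp: ballot_words_def)
qed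

lemma closing_word_in_ballot_words:
  assumes "P \<in> partial_ncp n"
  shows "closing_word n P \<in> ballot_words n"
  using assms
proof (induction n arbitrary: P)
  case 0
  then show ?case by (simp add: closing_word_def ballot_words_def)
next
  case (Suc n)
  have "card (\<Union>P) \<le> Suc n"
    using Suc.prems card_mono[of "{1..Suc n}" "\<Union>P"] by (auto simp: partial_ncp_def)
  then have s: "sum_list (closing_word (Suc n) P) \<le> Suc n"
    using sum_list_closing_word[OF Suc.prems] by simp
  from Suc.prems show ?case
  proof (cases rule: partial_ncp_Suc_cases)
    case opened
    then show ?thesis using s Suc.IH by (simp add: closing_word_Suc_open ballot_words_snoc)
  next
    case (closed Q B)
    have B: "B \<subseteq> {1..Suc n}" using closed(2) by (auto simp: top_segment_def)
    show ?thesis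
      using closing_word_Suc_close(2)[OF closed(1) B closed(3)] closed Suc.IH s
      by (simp add: ballot_words_snoc)
  qed
qed

text \<open>
  The last letter tells whether the last step closed a block and, if so, its size. The size
  singles out one top segment of the pending elements, which are known by induction.
\<close>

lemma inj_closing_word: "inj_on (closing_word n) (partial_ncp n)"
proof (induction n)
  case 0
  then show ?case by (auto simp: partial_ncp_def inj_on_def)
next
  case (Suc n)
  have word_close: "closing_word (Suc n) (insert B Q) = closing_word n Q @ [card B]" "card B > 0"
    if "Q \<in> partial_ncp n" "top_segment ({1..Suc n} - \<Union>Q) B" "Suc n \<in> B" for Q B
  proof -
    have B: "B \<subseteq> {1..Suc n}" using that(2) by (auto simp: top_segment_def)
    show "closing_word (Suc n) (insert B Q) = closing_word n Q @ [card B]"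
      using closing_word_Suc_close(2)[OF that(1) B that(3)] .
    show "card B > 0" using B that(3) by (auto simp: card_gt_0_iff intro: finite_subset)
  qed
  show ?case
  proof (rule inj_onI)
    fix P P' assume P: "P \<in> partial_ncp (Suc n)" and P': "P' \<in> partial_ncp (Suc n)"
      and eq: "closing_word (Suc n) P = closing_word (Suc n) P'"
    from P show "P = P'"
    proof (cases rule: partial_ncp_Suc_cases)
      case opened
      note P1 = opened
      from P' show ?thesis
      proof (cases rule: partial_ncp_Suc_cases)
        case opened
        then show ?thesis using P1 eq Suc.IH by (auto simp: closing_word_Suc_open inj_on_def)
      next
        case (closed Q B)
        then show ?thesis using P1 eq word_close[of Q B] by (simp add: closing_word_Suc_open)
      qed
    next
      case (closed Q B)
      note Q = closed
      from P' show ?thesis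
      proof (cases rule: partial_ncp_Suc_cases)
        case opened
        then show ?thesis using eq Q word_close[of Q B] by (simp add: closing_word_Suc_open)
      next
        case (closed Q' B')
        have e: "closing_word n Q = closing_word n Q'" "card B = card B'"
          using eq Q closed word_close[of Q B] word_close[of Q' B'] by simp_all
        then have "Q = Q'" using Suc.IH Q(1) closed(1) by (auto simp: inj_on_def)
        then show ?thesis
          using top_segment_unique[of "{1..Suc n} - \<Union>Q" B B'] e(2) Q closed by simp
      qed
    qed
  qed
qed

text \<open>
  The prefix condition says that enough pending elements are available for every letter.
\<close>

lemma ballot_words_subset_closing_words:
  assumes "c \<in> ballot_words n"
  shows "c \<in> closing_word n ` partial_ncp n"
  using assms
proof (induction n arbitrary: c)
  case 0
  have "{} \<in> partial_ncp 0" by (auto simp: partial_ncp_def noncrossing_def)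
  then show ?case using 0 by (auto simp: ballot_words_def closing_word_def image_iff)
next
  case (Suc n)
  have "length c = Suc n" using Suc.prems by (simp add: ballot_words_def)
  then obtain d s where c: "c = d @ [s]" by (metis length_Suc_conv_rev)
  have d: "d \<in> ballot_words n" "sum_list d + s \<le> Suc n"
    using Suc.prems ballot_words_snoc c by auto
  from Suc.IH[OF d(1)] obtain Q where Q: "Q \<in> partial_ncp n" "d = closing_word n Q" by auto
  show ?case
  proof (cases "s = 0")
    case True
    then show ?thesis
      using Q c closing_word_Suc_open[OF Q(1)] partial_ncp_mono[OF Q(1)] by (intro image_eqI[of _ _ Q]) auto
  next
    case False
    let ?A = "{1..Suc n} - \<Union>Q"
    have sub: "\<Union>Q \<subseteq> {1..n}" using Q(1) by (auto simp: partial_ncp_def)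
    have "card ?A = Suc n - card (\<Union>Q)"
      using sub finite_partial_ncp(2)[OF Q(1)] by (subst card_Diff_subset) auto
    then have "s \<le> card ?A" using d(2) sum_list_closing_word[OF Q(1)] Q(2) by simp
    then obtain B where B: "top_segment ?A B" "card B = s"
      using top_segment_exists[of ?A s] by auto
    have BA: "B \<subseteq> ?A" using B by (simp add: top_segment_def)
    \<comment> \<open>A nonempty top segment contains the largest pending element, which is \<open>Suc n\<close>.\<close>
    have "Suc n \<in> B"
    proof (rule ccontr)
      assume nb: "Suc n \<notin> B"
      obtain b where b: "b \<in> B" using B(2) False by fastforce
      have "Suc n \<in> ?A - B" using nb sub by fastforce
      then have "Suc n < b" using B(1) b by (auto simp: top_segment_def)
      then show False using b BA by auto
    qed
    moreover have "B \<subseteq> {1..Suc n}" using BA by blast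
    ultimately show ?thesis
      using partial_ncp_insert[OF Q(1) B(1)] closing_word_Suc_close(2)[OF Q(1), of B] B(2) Q(2) c
      by (intro image_eqI[of _ _ "insert B Q"]) simp_all
  qed
qed

text \<open>
  The partitions are the configurations in which nothing is pending; the condition on elements
  under a block is then vacuous.
\<close>

lemma noncrossing_partitions_eq:
  "noncrossing_partitions n = {P \<in> partial_ncp n. sum_list (closing_word n P) = n}"
proof -
  have cover: "P \<in> noncrossing_partitions n \<longleftrightarrow> P \<in> partial_ncp n \<and> \<Union>P = {1..n}" for P
  proof -
    have "\<forall>A\<in>P. \<forall>a\<in>A. \<forall>b\<in>A. {a..b} \<subseteq> \<Union>P" if U: "\<Union>P = {1..n}"
    proof (intro ballI)
      fix A a b assume "A \<in> P" "a \<in> A" "b \<in> A"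
      then have "a \<in> {1..n}" "b \<in> {1..n}" using U by blast+
      then show "{a..b} \<subseteq> \<Union>P" unfolding U by auto
    qed
    moreover have "P \<in> noncrossing_partitions n \<longleftrightarrow>
        \<Union>P = {1..n} \<and> disjoint P \<and> {} \<notin> P \<and> noncrossing P"
      by (simp add: noncrossing_partitions_def partition_on_def conj_assoc)
    moreover have "P \<in> partial_ncp n \<longleftrightarrow> disjoint P \<and> {} \<notin> P \<and> \<Union>P \<subseteq> {1..n} \<and> noncrossing P \<and>
        (\<forall>A\<in>P. \<forall>a\<in>A. \<forall>b\<in>A. {a..b} \<subseteq> \<Union>P)"
      by (simp only: partial_ncp_def mem_Collect_eq)
    ultimately show ?thesis by (metis order_refl)
  qed
  have size: "\<Union>P = {1..n} \<longleftrightarrow> sum_list (closing_word n P) = n" if P: "P \<in> partial_ncp n" for P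
  proof -
    have "\<Union>P \<subseteq> {1..n}" using P unfolding partial_ncp_def by blast
    then have "\<Union>P = {1..n} \<longleftrightarrow> card (\<Union>P) = card {1..n}"
      using card_subset_eq[OF finite_atLeastAtMost, of "\<Union>P" 1 n] by (intro iffI) simp_all
    then show ?thesis unfolding sum_list_closing_word[OF P] by simp
  qed
  show ?thesis by (rule set_eqI) (simp only: cover mem_Collect_eq size cong: conj_cong)
qed

lemma bij_betw_closing_word:
  "bij_betw (closing_word n) (noncrossing_partitions n) {c \<in> ballot_words n. sum_list c = n}"
proof -
  have "closing_word n ` partial_ncp n = ballot_words n"
    using closing_word_in_ballot_words ballot_words_subset_closing_words by blast
  moreover have "closing_word n ` {P \<in> partial_ncp n. q (closing_word n P)} =
      {c \<in> closing_word n ` partial_ncp n. q c}" for q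
    by blast
  ultimately have "closing_word n ` noncrossing_partitions n = {c \<in> ballot_words n. sum_list c = n}"
    unfolding noncrossing_partitions_eq by simp
  moreover have "inj_on (closing_word n) (noncrossing_partitions n)"
    using inj_closing_word by (rule inj_on_subset) (auto simp: noncrossing_partitions_eq)
  ultimately show ?thesis by (simp add: bij_betw_def)
qed

section \<open>The cycle lemma\<close>

definition weak_compositions :: "nat \<Rightarrow> nat \<Rightarrow> nat list set" where
  "weak_compositions m N = {c. length c = m \<and> sum_list c = N}"

text \<open>
  The sequences that start with \<open>0\<close> and continue with a ballot word: shifting a word by one
  place turns its weak inequalities into strict ones.
\<close>

definition dominating :: "nat list \<Rightarrow> bool" where
  "dominating c \<longleftrightarrow> (\<forall>t\<in>{1..length c}. sum_list (take t c) < t)"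

lemma finite_weak_compositions: "finite (weak_compositions m N)"
proof (rule finite_subset)
  show "weak_compositions m N \<subseteq> {c. set c \<subseteq> {..N} \<and> length c = m}"
    by (auto simp: weak_compositions_def dest: member_le_sum_list)
  show "finite {c. set c \<subseteq> {..N} \<and> length c = m}" by (rule finite_lists_length_eq) simp
qed

lemma card_weak_compositions: "card (weak_compositions (Suc m) N) = (N + m) choose m"
  using card_length_sum_list[of "Suc m" N] binomial_symmetric[of N "N + m"]
  by (simp add: weak_compositions_def)

lemma mset_rotate: "mset (rotate r c) = mset c"
proof -
  have "mset (rotate1 d) = mset d" for d :: "'a list" by (cases d) auto
  then show ?thesis by (induction r) (auto simp: rotate_Suc)
qed

lemma sum_list_rotate: "sum_list (rotate r c) = sum_list (c :: nat list)"
  by (metis mset_rotate sum_mset_sum_list)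

lemma sum_list_take_rotate:
  fixes c :: "nat list"
  assumes "t \<le> length c"
  shows "sum_list (take t (rotate r c)) = (\<Sum>j=r..<r+t. c ! (j mod length c))"
proof -
  have "sum_list (take t (rotate r c)) = (\<Sum>i=0..<t. rotate r c ! i)"
    using assms by (simp add: sum_list_sum_nth)
  also have "\<dots> = (\<Sum>i=0..<t. c ! ((r + i) mod length c))"
    using assms by (intro sum.cong) (auto simp: nth_rotate add.commute)
  also have "\<dots> = (\<Sum>j=r..<r+t. c ! (j mod length c))"
    using sum.shift_bounds_nat_ivl[of "\<lambda>j. c ! (j mod length c)" 0 r t]
    by (simp add: add.commute)
  finally show ?thesis .
qed

text \<open>
  For the walk \<open>S\<close> with steps \<open>1 - c ! j\<close>, continued periodically, the rotation by \<open>r\<close> is dominating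
  iff \<open>S\<close> stays strictly above \<open>S r\<close> during the period that follows \<open>r\<close>. Over one period \<open>S\<close> rises by
  exactly \<open>1\<close>, so the last minimum in a period is a suitable \<open>r\<close>. Two suitable places \<open>r < r'\<close>
  would give \<open>S r < S r' < S r + 1\<close>, which is impossible for integers.
\<close>

lemma cycle_lemma:
  assumes c: "c \<in> weak_compositions (Suc n) n"
  shows "\<exists>!r. r < Suc n \<and> dominating (rotate r c)"
proof -
  define S where "S i = int i - (\<Sum>j=0..<i. int (c ! (j mod Suc n)))" for i
  have len: "length c = Suc n" and tot: "sum_list c = n"
    using c by (auto simp: weak_compositions_def)
  have diff: "S (r + t) - S r = int t - int (sum_list (take t (rotate r c)))" if "t \<le> Suc n" for r t
    using that len sum.atLeastLessThan_concat[of 0 r "r + t" "\<lambda>j. int (c ! (j mod Suc n))"]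
    by (simp add: S_def sum_list_take_rotate)
  have period: "S (r + Suc n) = S r + 1" for r
  proof -
    have "sum_list (take (Suc n) (rotate r c)) = n"
      using len tot by (simp add: sum_list_rotate)
    then show ?thesis using diff[of "Suc n" r] by simp
  qed
  have dom: "dominating (rotate r c) \<longleftrightarrow> (\<forall>t\<in>{1..Suc n}. S r < S (r + t))" for r
  proof -
    have "S r < S (r + t) \<longleftrightarrow> sum_list (take t (rotate r c)) < t" if "t \<le> Suc n" for t
      using diff[OF that, of r] by linarith
    then show ?thesis unfolding dominating_def by (simp add: len)
  qed
  show ?thesis
  proof (rule ex_ex1I)
    define m where "m = Min (S ` {..n})"
    define r where "r = Max {i \<in> {..n}. S i = m}"
    have "m \<in> S ` {..n}" unfolding m_def by (rule Min_in) auto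
    then have "{i \<in> {..n}. S i = m} \<noteq> {}" by auto
    from Max_in[OF _ this] have r: "r \<le> n" "S r = m" by (auto simp: r_def)
    have min: "m \<le> S i" if "i \<le> n" for i using that by (auto simp: m_def)
    have last: "m < S i" if "r < i" "i \<le> n" for i
    proof -
      have "i \<le> r" if "S i = m"
        unfolding r_def by (rule Max_ge) (use that \<open>i \<le> n\<close> in auto)
      then have "S i \<noteq> m" using that(1) by auto
      then show ?thesis using min[OF that(2)] by simp
    qed
    have "S r < S (r + t)" if "t \<in> {1..Suc n}" for t
    proof (cases "r + t \<le> n")
      case True
      then show ?thesis using last[of "r + t"] r that by simp
    next
      case False
      then have "r + t = (r + t - Suc n) + Suc n" by simp
      then have "S (r + t) = S (r + t - Suc n) + 1" using period by metis
      moreover have "r + t - Suc n \<le> n" using r that by auto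
      ultimately show ?thesis using min[of "r + t - Suc n"] r by simp
    qed
    then show "\<exists>r. r < Suc n \<and> dominating (rotate r c)" using dom r by (auto simp: less_Suc_eq_le)
  next
    have no: False
      if "r < r'" "r' < Suc n" "dominating (rotate r c)" "dominating (rotate r' c)" for r r'
    proof -
      have "S r < S (r + (r' - r))" using dom that by fastforce
      moreover have "S r' < S (r' + (r + Suc n - r'))" using dom that by fastforce
      ultimately show False using that period[of r] by simp
    qed
    fix r r' assume "r < Suc n \<and> dominating (rotate r c)" "r' < Suc n \<and> dominating (rotate r' c)"
    then show "r = r'" using no[of r r'] no[of r' r] by (meson linorder_neqE_nat)
  qed
qed

lemma bij_betw_rotate_weak_compositions:
  "bij_betw (rotate r) (weak_compositions m N) (weak_compositions m N)"
proof -
  have sub: "rotate r ` weak_compositions m N \<subseteq> weak_compositions m N"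
    by (auto simp: weak_compositions_def sum_list_rotate)
  have inj: "inj_on (rotate r) (weak_compositions m N)"
    by (metis bij_def bij_rotate1 inj_fn inj_on_subset rotate_def subset_UNIV)
  show ?thesis
    unfolding bij_betw_def using inj sub endo_inj_surj[OF finite_weak_compositions] by blast
qed

text \<open>
  Counting the pairs of a sequence and a rotation that makes it dominating in two ways: one
  rotation for each sequence by the cycle lemma, and each rotation permutes the sequences.
\<close>

lemma sum_dominating:
  fixes F :: "nat multiset \<Rightarrow> nat"
  shows "(\<Sum>c\<in>weak_compositions (Suc n) n. F (mset c)) =
    Suc n * (\<Sum>c | c \<in> weak_compositions (Suc n) n \<and> dominating c. F (mset c))"
proof -
  let ?W = "weak_compositions (Suc n) n"
  have "(\<Sum>c\<in>?W. F (mset c)) =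
      (\<Sum>c\<in>?W. \<Sum>r<Suc n. if dominating (rotate r c) then F (mset c) else 0)"
  proof (rule sum.cong)
    fix c assume "c \<in> ?W"
    then obtain r where r: "r < Suc n" and u: "\<And>s. s < Suc n \<Longrightarrow> dominating (rotate s c) \<longleftrightarrow> s = r"
      using cycle_lemma by metis
    have "(\<Sum>s<Suc n. if dominating (rotate s c) then F (mset c) else 0) =
        (\<Sum>s<Suc n. if s = r then F (mset c) else 0)"
      by (rule sum.cong) (simp_all only: lessThan_iff u)
    then show "F (mset c) = (\<Sum>s<Suc n. if dominating (rotate s c) then F (mset c) else 0)"
      using r by (simp del: sum.lessThan_Suc)
  qed simp
  also have "\<dots> = (\<Sum>r<Suc n. \<Sum>c\<in>?W. if dominating (rotate r c) then F (mset (rotate r c)) else 0)"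
    by (subst sum.swap) (simp only: mset_rotate)
  also have "\<dots> = (\<Sum>r<Suc n. \<Sum>c\<in>?W. if dominating c then F (mset c) else 0)"
    by (intro sum.cong refl sum.reindex_bij_betw bij_betw_rotate_weak_compositions)
  also have "\<dots> = Suc n * (\<Sum>c\<in>?W. if dominating c then F (mset c) else 0)"
    by simp
  also have "(\<Sum>c\<in>?W. if dominating c then F (mset c) else 0) =
      (\<Sum>c | c \<in> ?W \<and> dominating c. F (mset c))"
    by (subst sum.inter_filter) (auto simp: finite_weak_compositions)
  finally show ?thesis .
qed

lemma dominating_weak_compositions:
  "{c \<in> weak_compositions (Suc n) n. dominating c} = (#) 0 ` {c \<in> ballot_words n. sum_list c = n}"
proof -
  have "dominating (0 # c) \<longleftrightarrow> (\<forall>t\<le>n. sum_list (take t c) \<le> t)" if "length c = n" for c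
  proof -
    have "dominating (0 # c) \<longleftrightarrow> (\<forall>t\<in>Suc ` {0..n}. sum_list (take t (0 # c)) < t)"
      unfolding dominating_def using that by (simp add: image_Suc_atLeastAtMost)
    also have "\<dots> \<longleftrightarrow> (\<forall>t\<le>n. sum_list (take t c) \<le> t)"
      by (auto simp: less_Suc_eq_le simp del: image_Suc_atLeastAtMost)
    finally show ?thesis .
  qed
  then have 1: "dominating (0 # c) \<longleftrightarrow> c \<in> ballot_words n" if "length c = n" for c
    using that by (simp add: ballot_words_def)
  have 2: "x = 0" if "dominating (x # c)" for x c
    using that by (auto simp: dominating_def dest: bspec[of _ _ 1])
  show ?thesis
  proof (intro equalityI subsetI)
    fix c assume c: "c \<in> {c \<in> weak_compositions (Suc n) n. dominating c}"
    then obtain x d where xd: "c = x # d" "length d = n"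
      by (auto simp: weak_compositions_def length_Suc_conv)
    with c have "x = 0" using 2 by blast
    then show "c \<in> (#) 0 ` {c \<in> ballot_words n. sum_list c = n}"
      using c xd 1[of d] by (auto simp: weak_compositions_def)
  next
    fix c assume "c \<in> (#) 0 ` {c \<in> ballot_words n. sum_list c = n}"
    then obtain d where d: "c = 0 # d" "d \<in> ballot_words n" "sum_list d = n" by auto
    then have "length d = n" by (simp add: ballot_words_def)
    then show "c \<in> {c \<in> weak_compositions (Suc n) n. dominating c}"
      using d 1[of d] by (simp add: weak_compositions_def)
  qed
qed

lemma sum_noncrossing_partitions:
  fixes F :: "nat multiset \<Rightarrow> nat"
  shows "Suc n * (\<Sum>P\<in>noncrossing_partitions n. F (mset (0 # closing_word n P))) =
    (\<Sum>c\<in>weak_compositions (Suc n) n. F (mset c))"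
proof -
  have "(\<Sum>c | c \<in> weak_compositions (Suc n) n \<and> dominating c. F (mset c)) =
      (\<Sum>c | c \<in> ballot_words n \<and> sum_list c = n. F (mset (0 # c)))"
    unfolding dominating_weak_compositions by (subst sum.reindex) auto
  also have "\<dots> = (\<Sum>P\<in>noncrossing_partitions n. F (mset (0 # closing_word n P)))"
    by (rule sum.reindex_bij_betw[OF bij_betw_closing_word, symmetric])
  finally show ?thesis using sum_dominating[of F n] by simp
qed


section \<open>Factorial moments of the block counts\<close>

text \<open>
  The factor \<open>count (mset c) k\<close> marks a position with letter \<open>k\<close>. Deleting the marked letter
  gives a shorter sequence, into which \<open>k\<close> can be inserted again at any of \<open>Suc m\<close> places.
\<close>

lemma sum_weak_compositions_mark:
  fixes h :: "nat multiset \<Rightarrow> nat"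
  shows "(\<Sum>c\<in>weak_compositions (Suc m) N. count (mset c) k * h (mset c - {#k#})) =
    (if k \<le> N then Suc m * (\<Sum>d\<in>weak_compositions m (N - k). h (mset d)) else 0)"
proof -
  let ?W = "weak_compositions (Suc m) N"
  have "(\<Sum>c\<in>?W. count (mset c) k * h (mset c - {#k#})) =
      (\<Sum>c\<in>?W. \<Sum>i<Suc m. if c ! i = k then h (mset c - {#k#}) else 0)"
  proof (rule sum.cong)
    fix c assume "c \<in> ?W"
    then have "count (mset c) k = card {i. i < Suc m \<and> c ! i = k}"
      by (simp add: count_mset count_list_eq_length_filter length_filter_conv_card
          weak_compositions_def eq_commute)
    also have "{i. i < Suc m \<and> c ! i = k} = {i \<in> {..<Suc m}. c ! i = k}" by auto
    finally show "count (mset c) k * h (mset c - {#k#}) =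
        (\<Sum>i<Suc m. if c ! i = k then h (mset c - {#k#}) else 0)"
      by (simp add: sum.inter_filter[symmetric] del: sum.lessThan_Suc)
  qed simp
  also have "\<dots> = (\<Sum>i<Suc m. \<Sum>c\<in>?W. if c ! i = k then h (mset c - {#k#}) else 0)"
    by (rule sum.swap)
  also have "\<dots> = (\<Sum>i<Suc m. if k \<le> N then \<Sum>d\<in>weak_compositions m (N - k). h (mset d) else 0)"
  proof (rule sum.cong)
    fix i assume i: "i \<in> {..<Suc m}"
    have "(\<Sum>c\<in>?W. if c ! i = k then h (mset c - {#k#}) else 0) =
        (\<Sum>c | c \<in> ?W \<and> c ! i = k. h (mset c - {#k#}))"
      by (subst sum.inter_filter) (auto simp: finite_weak_compositions)
    also have "\<dots> = (if k \<le> N then \<Sum>d\<in>weak_compositions m (N - k). h (mset d) else 0)"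
    proof (cases "k \<le> N")
      case True
      have "(\<Sum>c | c \<in> ?W \<and> c ! i = k. h (mset c - {#k#})) =
          (\<Sum>d\<in>weak_compositions m (N - k). h (mset d))"
      proof (rule sum.reindex_bij_witness[where i = "\<lambda>d. take i d @ k # drop i d"
            and j = "\<lambda>c. take i c @ drop (Suc i) c"])
        fix c assume c: "c \<in> {c. c \<in> ?W \<and> c ! i = k}"
        then have split: "c = take i c @ k # drop (Suc i) c"
          using i by (auto simp: weak_compositions_def id_take_nth_drop)
        have len: "length c = Suc m" "sum_list c = N" using c by (auto simp: weak_compositions_def)
        have li: "length (take i c) = i" using len i by simp
        show "take i (take i c @ drop (Suc i) c) @ k # drop i (take i c @ drop (Suc i) c) = c"
          using split li by simp
        have "sum_list c = sum_list (take i c) + (k + sum_list (drop (Suc i) c))"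
          by (subst split) simp
        then show "take i c @ drop (Suc i) c \<in> weak_compositions m (N - k)"
          using len i by (auto simp: weak_compositions_def)
        have "mset c = mset (take i c) + (add_mset k (mset (drop (Suc i) c)))"
          by (subst split) simp
        then show "h (mset (take i c @ drop (Suc i) c)) = h (mset c - {#k#})" by simp
      next
        fix d assume d: "d \<in> weak_compositions m (N - k)"
        then have li: "length (take i d) = i" using i by (simp add: weak_compositions_def)
        show "take i (take i d @ k # drop i d) @ drop (Suc i) (take i d @ k # drop i d) = d"
          using li by simp
        have "sum_list d = sum_list (take i d) + sum_list (drop i d)"
          by (metis append_take_drop_id sum_list_append)
        then show "take i d @ k # drop i d \<in> {c. c \<in> ?W \<and> c ! i = k}"
          using d i True li by (auto simp: weak_compositions_def nth_append)
      qed
      then show ?thesis using True by simp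
    next
      case False
      have "c ! i \<le> N" if "c \<in> ?W" for c
        using that i elem_le_sum_list[of i c] by (auto simp: weak_compositions_def)
      then have "{c. c \<in> ?W \<and> c ! i = k} = {}"
        using False by auto
      then show ?thesis using False by (simp only: sum.empty if_False)
    qed
    finally show "(\<Sum>c\<in>?W. if c ! i = k then h (mset c - {#k#}) else 0) = \<dots>" .
  qed simp
  also have "\<dots> = (if k \<le> N then Suc m * (\<Sum>d\<in>weak_compositions m (N - k). h (mset d)) else 0)"
    by simp
  finally show ?thesis .
qed

definition block_count :: "nat \<Rightarrow> nat set set \<Rightarrow> nat" where
  "block_count l P = card {B \<in> P. card B = l}"

lemma count_closing_word_noncrossing:
  assumes "P \<in> noncrossing_partitions n" "l \<ge> 1"
  shows "count (mset (0 # closing_word n P)) l = block_count l P"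
  using count_closing_word[of P n l] assms
  by (simp add: count_mset noncrossing_partitions_eq block_count_def)

lemma card_noncrossing_partitions: "Suc n * card (noncrossing_partitions n) = (2 * n) choose n"
  using sum_noncrossing_partitions[of n "\<lambda>_. 1"]
  by (simp add: card_weak_compositions mult_2)

text \<open>
  Marking and deleting one letter \<open>l\<close> leaves an arbitrary sequence of length \<open>n\<close> and sum \<open>n - l\<close>.
\<close>

lemma sum_block_count:
  assumes l: "l \<ge> 1" and n: "n \<ge> 1"
  shows "(\<Sum>P\<in>noncrossing_partitions n. block_count l P) =
    (if l \<le> n then (2 * n - l - 1) choose (n - 1) else 0)"
proof -
  obtain m where m: "n = Suc m" using n by (cases n) auto
  have "Suc n * (\<Sum>P\<in>noncrossing_partitions n. block_count l P) =
      Suc n * (\<Sum>P\<in>noncrossing_partitions n. count (mset (0 # closing_word n P)) l)"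
    using count_closing_word_noncrossing l by simp
  also have "\<dots> = (\<Sum>c\<in>weak_compositions (Suc n) n. count (mset c) l)"
    using sum_noncrossing_partitions[of n "\<lambda>M. count M l"] by simp
  also have "\<dots> = (if l \<le> n then Suc n * card (weak_compositions n (n - l)) else 0)"
    using sum_weak_compositions_mark[where k = l and m = n and N = n and h = "\<lambda>_. 1"] by simp
  also have "\<dots> = Suc n * (if l \<le> n then (2 * n - l - 1) choose (n - 1) else 0)"
  proof (cases "l \<le> n")
    case True
    then have "n - l + m = 2 * n - l - 1" using m by simp
    then show ?thesis using True m card_weak_compositions[of m "n - l"] by simp
  qed simp
  finally show ?thesis by (simp del: mult_Suc)
qed

text \<open>
  The summand counts the ordered pairs of distinct blocks of sizes \<open>k\<close> and \<open>l\<close>: after a letter \<open>k\<close>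
  has been deleted, the number of letters \<open>l\<close> has dropped by one exactly if \<open>k = l\<close>. Marking
  twice leaves sequences of length \<open>n - 1\<close> and sum \<open>n - k - l\<close>.
\<close>

lemma sum_block_count_pair:
  assumes kl: "k \<ge> 1" "l \<ge> 1" and n: "n \<ge> 2" "k + l \<le> n"
  shows "(\<Sum>P\<in>noncrossing_partitions n. block_count k P * (block_count l P - (if l = k then 1 else 0))) =
    n * ((2 * n - k - l - 2) choose (n - 2))"
proof -
  obtain m where m: "n = Suc (Suc m)" using n by (metis add_2_eq_Suc le_Suc_ex)
  define h where "h M = count M l" for M :: "nat multiset"
  have "Suc n * (\<Sum>P\<in>noncrossing_partitions n. block_count k P * (block_count l P - (if l = k then 1 else 0))) =
      Suc n * (\<Sum>P\<in>noncrossing_partitions n. (\<lambda>M. count M k * h (M - {#k#})) (mset (0 # closing_word n P)))"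
    unfolding h_def count_diff using count_closing_word_noncrossing[of _ n] kl
    by (auto intro!: sum.cong)
  also have "\<dots> = (\<Sum>c\<in>weak_compositions (Suc n) n. count (mset c) k * h (mset c - {#k#}))"
    by (rule sum_noncrossing_partitions)
  also have "\<dots> = Suc n * (\<Sum>d\<in>weak_compositions n (n - k). h (mset d))"
    using n by (subst sum_weak_compositions_mark) simp
  also have "(\<Sum>d\<in>weak_compositions n (n - k). h (mset d)) = n * card (weak_compositions (Suc m) (n - k - l))"
    using sum_weak_compositions_mark[where k = l and m = "Suc m" and N = "n - k" and h = "\<lambda>_. 1"] n m
    by (simp add: h_def)
  also have "n - k - l + m = 2 * n - k - l - 2" using n m by simp
  then have "card (weak_compositions (Suc m) (n - k - l)) = (2 * n - k - l - 2) choose (n - 2)"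
    using card_weak_compositions[of m "n - k - l"] m by simp
  finally show ?thesis by (simp del: mult_Suc)
qed

section \<open>Expectations under the uniform distribution\<close>

lemma expectation_random_ncp:
  "measure_pmf.expectation (random_ncp n) X =
    (\<Sum>P\<in>noncrossing_partitions n. X P) / card (noncrossing_partitions n)"
  unfolding random_ncp_def
  using noncrossing_partitions_nonempty finite_noncrossing_partitions by (rule integral_pmf_of_set)

lemma pmf_covariance_eq:
  assumes "finite (set_pmf p)"
  shows "pmf_covariance p X Y = measure_pmf.expectation p (\<lambda>x. X x * Y x) -
    measure_pmf.expectation p X * measure_pmf.expectation p Y"
proof -
  have int: "integrable (measure_pmf p) Z" for Z :: "'a \<Rightarrow> real"
    using assms by (rule integrable_measure_pmf_finite)
  define \<mu> \<nu> where "\<mu> = measure_pmf.expectation p X" and "\<nu> = measure_pmf.expectation p Y"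
  have "pmf_covariance p X Y =
      measure_pmf.expectation p (\<lambda>x. X x * Y x - \<mu> * Y x - \<nu> * X x + \<mu> * \<nu>)"
    unfolding pmf_covariance_def \<mu>_def[symmetric] \<nu>_def[symmetric]
    by (rule Bochner_Integration.integral_cong) (simp_all add: algebra_simps)
  also have "\<dots> = measure_pmf.expectation p (\<lambda>x. X x * Y x) - \<mu> * \<nu> - \<nu> * \<mu> + \<mu> * \<nu>"
    by (simp add: int Bochner_Integration.integral_add Bochner_Integration.integral_diff \<mu>_def \<nu>_def)
  finally show ?thesis by (simp add: \<mu>_def \<nu>_def)
qed

lemma variance_eq_pmf_covariance: "measure_pmf.variance p X = pmf_covariance p X X"
  by (simp add: pmf_covariance_def power2_eq_square)

lemma finite_set_random_ncp: "finite (set_pmf (random_ncp n))"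
  using noncrossing_partitions_nonempty[of n] finite_noncrossing_partitions[of n]
  by (simp add: random_ncp_def)

lemma num_blocks_eq: "num_blocks l P = real (block_count l P)"
  by (simp add: num_blocks_def block_count_def)

text \<open>
  With subtraction of real numbers this recurrence also holds for \<open>k > M\<close>, so the induction for
  the first moments can run past the point where the binomial coefficient vanishes.
\<close>

lemma binomial_decrease_top:
  "real M * real ((M - 1) choose k) = (real M - real k) * real (M choose k)"
proof (cases "k \<le> M")
  case True
  have "real (M * ((M - 1) choose k)) = real ((M - k) * (M choose k))"
    by (simp only: binomial_absorb_comp)
  then show ?thesis using True by (simp add: of_nat_diff)
qed (auto simp: binomial_eq_0)

lemma central_binomial_half:
  assumes "n \<ge> 1"
  shows "real ((2 * n) choose n) = 2 * real ((2 * n - 1) choose (n - 1))"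
proof -
  have "real (n * ((2 * n) choose n)) = real (2 * n * ((2 * n - 1) choose (n - 1)))"
    using times_binomial_minus1_eq[of n "2 * n"] assms by (simp only:)
  then show ?thesis using assms by simp
qed

text \<open>
  Lowering the upper index one by one multiplies the binomial coefficient by a linear fraction each
  time; the factor for \<open>j = 0\<close> comes from comparing with the central coefficient. For \<open>l > n\<close>
  both sides are \<open>0\<close>.
\<close>

lemma binomial_ratio_pred:
  assumes "l < 2 * n"
  shows "real (n + 1) * real ((2 * n - l - 1) choose (n - 1)) =
    real ((2 * n) choose n) * (real n * (\<Prod>j=0..l. (real n + 1 - real j) / (2 * real n - real j)))"
  using assms
proof (induction l)
  case 0
  then show ?case using central_binomial_half[of n] by (simp add: field_simps)
next
  case (Suc l)
  define M where "M = 2 * n - l - 1"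
  have M: "M > 0" "real M = 2 * real n - real (Suc l)" "2 * n - Suc l - 1 = M - 1"
    using Suc.prems by (auto simp: M_def)
  have "real M * real ((M - 1) choose (n - 1)) = (real n - real l) * real (M choose (n - 1))"
    using binomial_decrease_top[of M "n - 1"] M Suc.prems by (simp add: of_nat_diff)
  then have "real ((M - 1) choose (n - 1)) =
      real (M choose (n - 1)) * ((real n + 1 - real (Suc l)) / (2 * real n - real (Suc l)))"
    using M by (simp add: field_simps)
  then show ?case using Suc M by (simp add: M_def)
qed

lemma binomial_ratio_pred_pred:
  assumes "n \<ge> 2" "m \<le> n"
  shows "real ((2 * n - 2 - m) choose (n - 2)) =
    real ((2 * n) choose n) * ((real n - 1) / (2 * (2 * real n - 1)) *
      (\<Prod>i<m. (real n - real i) / (2 * real n - 2 - real i)))"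
  using assms(2)
proof (induction m)
  case 0
  have 1: "real ((2 * n) choose n) = 2 * real ((2 * n - 1) choose (n - 1))"
    using assms by (intro central_binomial_half) simp
  have "(n - 1) * ((2 * n - 1) choose (n - 1)) = (2 * n - 1) * ((2 * n - 2) choose (n - 2))"
    using times_binomial_minus1_eq[of "n - 1" "2 * n - 1"] assms by (simp add: numeral_2_eq_2)
  then have "real (n - 1) * real ((2 * n - 1) choose (n - 1)) =
      real (2 * n - 1) * real ((2 * n - 2) choose (n - 2))"
    unfolding of_nat_mult[symmetric] by (rule arg_cong)
  then show ?case using 1 assms by (simp add: of_nat_diff field_simps)
next
  case (Suc m)
  define M where "M = 2 * n - 2 - m"
  have M: "M > 0" "real M = 2 * real n - 2 - real m" "2 * n - 2 - Suc m = M - 1"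
    using Suc.prems assms by (auto simp: M_def)
  have "real M * real ((M - 1) choose (n - 2)) = (real n - real m) * real (M choose (n - 2))"
    using binomial_decrease_top[of M "n - 2"] M assms by (simp add: of_nat_diff)
  then have "real ((M - 1) choose (n - 2)) =
      real (M choose (n - 2)) * ((real n - real m) / (2 * real n - 2 - real m))"
    using M by (simp add: field_simps)
  then show ?case using Suc M by (simp add: M_def)
qed

lemma card_noncrossing_partitions_real:
  "real (card (noncrossing_partitions n)) = real ((2 * n) choose n) / (real n + 1)"
proof -
  have "real (Suc n) * real (card (noncrossing_partitions n)) = real ((2 * n) choose n)"
    using card_noncrossing_partitions[of n] by (simp only: of_nat_mult[symmetric])
  then show ?thesis by (simp add: field_simps)
qed

lemma expectation_num_blocks:
  assumes "l \<ge> 1" "n \<ge> 1" "l < 2 * n"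
  shows "measure_pmf.expectation (random_ncp n) (num_blocks l) =
    real n * (\<Prod>j=0..l. (real n + 1 - real j) / (2 * real n - real j))"
proof -
  have "(\<Sum>P\<in>noncrossing_partitions n. num_blocks l P) = real ((2 * n - l - 1) choose (n - 1))"
  proof -
    have "(\<Sum>P\<in>noncrossing_partitions n. num_blocks l P) =
        real (\<Sum>P\<in>noncrossing_partitions n. block_count l P)"
      by (simp add: num_blocks_eq)
    also have "\<dots> = real ((2 * n - l - 1) choose (n - 1))"
      using assms by (simp add: sum_block_count binomial_eq_0)
    finally show ?thesis .
  qed
  moreover have "real ((2 * n) choose n) > 0" by simp
  ultimately show ?thesis
    using binomial_ratio_pred[OF assms(3)]
    by (simp add: expectation_random_ncp card_noncrossing_partitions_real field_simps del: zero_less_binomial_iff)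
qed

text \<open>
  The mean is added for \<open>k = l\<close> because \<open>X\<^sup>2 = X * (X - 1) + X\<close>.
\<close>

lemma expectation_num_blocks_pair:
  assumes "k \<ge> 1" "l \<ge> 1" "n \<ge> 2" "k + l \<le> n"
  shows "measure_pmf.expectation (random_ncp n) (\<lambda>P. num_blocks k P * num_blocks l P) =
    real n * (real n + 1) * ((real n - 1) / (2 * (2 * real n - 1)) *
      (\<Prod>i<k + l. (real n - real i) / (2 * real n - 2 - real i))) +
    (if k = l then measure_pmf.expectation (random_ncp n) (num_blocks k) else 0)"
proof -
  let ?C = "real ((2 * n) choose n)"
  have pos: "?C > 0" by simp
  have pt: "num_blocks k P * num_blocks l P =
      real (block_count k P * (block_count l P - (if l = k then 1 else 0))) +
      (if k = l then num_blocks k P else 0)" for P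
    by (cases "block_count k P") (auto simp: num_blocks_eq algebra_simps)
  have "(\<Sum>P\<in>noncrossing_partitions n.
        real (block_count k P * (block_count l P - (if l = k then 1 else 0)))) =
      real (n * ((2 * n - k - l - 2) choose (n - 2)))"
    using sum_block_count_pair[OF assms] by (simp only: of_nat_sum[symmetric])
  also have "2 * n - k - l - 2 = 2 * n - 2 - (k + l)" by simp
  finally have S: "(\<Sum>P\<in>noncrossing_partitions n.
        real (block_count k P * (block_count l P - (if l = k then 1 else 0)))) =
      real n * real ((2 * n - 2 - (k + l)) choose (n - 2))"
    by simp
  have "measure_pmf.expectation (random_ncp n) (\<lambda>P. num_blocks k P * num_blocks l P) =
      real n * real ((2 * n - 2 - (k + l)) choose (n - 2)) * (real n + 1) / ?C +
      (if k = l then measure_pmf.expectation (random_ncp n) (num_blocks k) else 0)"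
    unfolding expectation_random_ncp pt sum.distrib S
    by (simp add: add_divide_distrib distrib_right card_noncrossing_partitions_real)
  then show ?thesis
    using pos unfolding binomial_ratio_pred_pred[OF assms(3,4)] by simp
qed


section \<open>First-order expansions in \<open>1 / n\<close>\<close>

definition first_order_expansion :: "(nat \<Rightarrow> real) \<Rightarrow> real \<Rightarrow> bool" where
  "first_order_expansion f c \<longleftrightarrow> (\<lambda>n. f n - 1 - c / real n) \<in> O(\<lambda>n. 1 / real n ^ 2)"

lemma first_order_expansion_one: "first_order_expansion (\<lambda>_. 1) 0"
  by (simp add: first_order_expansion_def)

lemma first_order_expansion_bounded:
  assumes "first_order_expansion f c"
  shows "f \<in> O(\<lambda>_. 1)"
proof -
  have r: "(\<lambda>n. f n - 1 - c / real n) \<in> O(\<lambda>_. 1)"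
    using assms unfolding first_order_expansion_def
    by (rule landau_o.big_trans) real_asymp
  have "(\<lambda>n. 1 + c / real n) \<in> O(\<lambda>_. 1 :: real)"
  proof (rule sum_in_bigo)
    have "(\<lambda>n. c * (1 / real n)) \<in> O(\<lambda>_. 1 :: real)"
      by (rule cmult_in_bigo_iff[THEN iffD2, OF disjI2]) real_asymp
    then show "(\<lambda>n. c / real n) \<in> O(\<lambda>_. 1 :: real)" by simp
  qed simp
  from sum_in_bigo(1)[OF r this] show ?thesis by simp
qed

text \<open>
  With remainders \<open>r\<close> and \<open>s\<close> of the two factors, the remainder of the product is
  \<open>r * g + (1 + c / n) * s + c * d / n\<^sup>2\<close>.
\<close>

lemma first_order_expansion_mult:
  assumes f: "first_order_expansion f c" and g: "first_order_expansion g d"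
  shows "first_order_expansion (\<lambda>n. f n * g n) (c + d)"
proof -
  let ?r = "\<lambda>n. f n - 1 - c / real n" and ?s = "\<lambda>n. g n - 1 - d / real n"
  have r: "?r \<in> O(\<lambda>n. 1 / real n ^ 2)" and s: "?s \<in> O(\<lambda>n. 1 / real n ^ 2)"
    using f g by (auto simp: first_order_expansion_def)
  have 1: "(\<lambda>n. ?r n * g n) \<in> O(\<lambda>n. 1 / real n ^ 2)"
    using landau_o.big.mult[OF r first_order_expansion_bounded[OF g]] by simp
  have "(\<lambda>n. c * (1 / real n)) \<in> O(\<lambda>n. 1 :: real)"
    by (rule cmult_in_bigo_iff[THEN iffD2, OF disjI2]) real_asymp
  then have b: "(\<lambda>n. 1 + c * (1 / real n)) \<in> O(\<lambda>n. 1 :: real)"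
    by (intro sum_in_bigo) simp_all
  have 2: "(\<lambda>n. (1 + c * (1 / real n)) * ?s n) \<in> O(\<lambda>n. 1 / real n ^ 2)"
    using landau_o.big.mult[OF b s] by simp
  have 3: "(\<lambda>n. c * d * (1 / real n ^ 2)) \<in> O(\<lambda>n. 1 / real n ^ 2)"
    by (rule cmult_in_bigo_iff[THEN iffD2, OF disjI2]) simp
  have "(\<lambda>n. ?r n * g n + (1 + c * (1 / real n)) * ?s n + c * d * (1 / real n ^ 2))
      \<in> O(\<lambda>n. 1 / real n ^ 2)"
    by (intro sum_in_bigo 1 2 3)
  also have "(\<lambda>n. ?r n * g n + (1 + c * (1 / real n)) * ?s n + c * d * (1 / real n ^ 2)) =
      (\<lambda>n. f n * g n - 1 - (c + d) / real n)"
    by (rule ext) (simp add: algebra_simps power2_eq_square add_divide_distrib)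
  finally show ?thesis by (simp add: first_order_expansion_def)
qed

lemma first_order_expansion_prod:
  assumes "finite A" "\<And>i. i \<in> A \<Longrightarrow> first_order_expansion (f i) (c i)"
  shows "first_order_expansion (\<lambda>n. \<Prod>i\<in>A. f i n) (\<Sum>i\<in>A. c i)"
  using assms
  by (induction A rule: finite_induct)
     (auto intro!: first_order_expansion_mult first_order_expansion_one)

text \<open>
  The remainder is exactly \<open>(b - a) * b / (n * (n - b))\<close>.
\<close>

lemma first_order_expansion_quotient:
  "first_order_expansion (\<lambda>n. (real n - a) / (real n - b)) (b - a)"
proof -
  have "(\<lambda>n. 1 / (real n * (real n - b))) \<in> O(\<lambda>n. 1 / real n ^ 2)" by real_asymp
  then have "(\<lambda>n. (b - a) * b * (1 / (real n * (real n - b)))) \<in> O(\<lambda>n. 1 / real n ^ 2)"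
    by (rule cmult_in_bigo_iff[THEN iffD2, OF disjI2])
  also have "?this \<longleftrightarrow> first_order_expansion (\<lambda>n. (real n - a) / (real n - b)) (b - a)"
    unfolding first_order_expansion_def
  proof (rule landau_o.big.in_cong)
    show "eventually (\<lambda>n. (b - a) * b * (1 / (real n * (real n - b))) =
        (real n - a) / (real n - b) - 1 - (b - a) / real n) sequentially"
      using eventually_gt_at_top[of "nat \<lceil>\<bar>b\<bar>\<rceil>"]
    proof eventually_elim
      case (elim n)
      then have "real n > \<bar>b\<bar>" by linarith
      then have "real n \<noteq> 0" "real n - b \<noteq> 0" by auto
      then show ?case by (simp add: divide_simps) (simp add: algebra_simps)
    qed
  qed
  finally show ?thesis .
qed

text \<open>
  The shape of a covariance: the second moment \<open>n\<^sup>2 * h\<close> and the product of the means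
  \<open>n * f\<close> and \<open>n * g\<close> agree up to order \<open>n\<close>, where the coefficients of the expansions decide.
\<close>

lemma first_order_expansion_product_difference:
  assumes f: "first_order_expansion f a" and g: "first_order_expansion g b"
    and h: "first_order_expansion h c"
  shows "(\<lambda>n. real n ^ 2 * h n - (real n * f n) * (real n * g n) - (c - a - b) * real n) \<in> O(\<lambda>_. 1)"
proof -
  have "(\<lambda>n. (h n - 1 - c / real n) - (f n * g n - 1 - (a + b) / real n)) \<in> O(\<lambda>n. 1 / real n ^ 2)"
    using h first_order_expansion_mult[OF f g] unfolding first_order_expansion_def
    by (rule sum_in_bigo)
  then have "(\<lambda>n. real n ^ 2 * ((h n - 1 - c / real n) - (f n * g n - 1 - (a + b) / real n)))
      \<in> O(\<lambda>n. real n ^ 2 * (1 / real n ^ 2))"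
    by (intro landau_o.big.mult) simp_all
  also have "(\<lambda>n. real n ^ 2 * (1 / real n ^ 2)) \<in> O(\<lambda>_. 1)" by real_asymp
  also have "(\<lambda>n. real n ^ 2 * ((h n - 1 - c / real n) - (f n * g n - 1 - (a + b) / real n))) =
      (\<lambda>n. real n ^ 2 * h n - (real n * f n) * (real n * g n) - (c - a - b) * real n)"
    by (rule ext) (simp add: field_simps power2_eq_square)
  finally show ?thesis .
qed

lemma first_order_expansion_linear:
  assumes "first_order_expansion f a"
  shows "(\<lambda>n. real n * f n - real n) \<in> O(\<lambda>_. 1)"
proof -
  have "(\<lambda>n. real n * (f n - 1 - a / real n)) \<in> O(\<lambda>n. real n * (1 / real n ^ 2))"
    using assms unfolding first_order_expansion_def by (intro landau_o.big.mult) simp_all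
  also have "(\<lambda>n. real n * (1 / real n ^ 2)) \<in> O(\<lambda>_. 1)" by real_asymp
  finally have 1: "(\<lambda>n. real n * (f n - 1 - a / real n)) \<in> O(\<lambda>_. 1)" .
  have "(\<lambda>n. a * (real n / real n)) \<in> O(\<lambda>_. 1)"
    by (rule cmult_in_bigo_iff[THEN iffD2, OF disjI2]) real_asymp
  from sum_in_bigo(1)[OF 1 this]
  have "(\<lambda>n. real n * (f n - 1 - a / real n) + a * (real n / real n)) \<in> O(\<lambda>_. 1)" .
  also have "(\<lambda>n. real n * (f n - 1 - a / real n) + a * (real n / real n)) =
      (\<lambda>n. real n * f n - real n)"
  proof
    fix n show "real n * (f n - 1 - a / real n) + a * (real n / real n) = real n * f n - real n"
      by (cases "n = 0") (simp_all add: field_simps)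
  qed
  finally show ?thesis .
qed

section \<open>Asymptotics of the moments\<close>

text \<open>
  The means and the factorial moments, divided by their leading terms \<open>n / 2 ^ (l + 1)\<close> and
  \<open>n\<^sup>2 / 2 ^ (m + 2)\<close> with \<open>m = k + l\<close>. Every factor is written as \<open>(n - a) / (n - b)\<close>,
  whose expansion is known.
\<close>

definition mean_factor :: "nat \<Rightarrow> nat \<Rightarrow> real" where
  "mean_factor l n = (\<Prod>j=0..l. (real n - (real j - 1)) / (real n - real j / 2))"

definition pair_factor :: "nat \<Rightarrow> nat \<Rightarrow> real" where
  "pair_factor m n = (real n - (-1)) / (real n - 0) * ((real n - 1) / (real n - 1 / 2) *
     (\<Prod>i<m. (real n - real i) / (real n - (1 + real i / 2))))"

lemma prod_half_scale:
  fixes c d e :: "'a \<Rightarrow> real"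
  assumes "finite A" "\<And>i. i \<in> A \<Longrightarrow> d i = 2 * e i"
  shows "(\<Prod>i\<in>A. c i / d i) = (\<Prod>i\<in>A. c i / e i) / 2 ^ card A"
proof -
  have "(\<Prod>i\<in>A. c i / d i) = (\<Prod>i\<in>A. c i / e i / 2)"
    by (rule prod.cong) (auto simp: assms(2))
  then show ?thesis by (simp only: prod_dividef prod_constant)
qed

lemma expectation_num_blocks_factor:
  assumes "l \<ge> 1" "n \<ge> 1" "l < 2 * n"
  shows "measure_pmf.expectation (random_ncp n) (num_blocks l) = real n * mean_factor l n / 2 ^ (l + 1)"
  unfolding expectation_num_blocks[OF assms] mean_factor_def
  by (subst prod_half_scale[where e = "\<lambda>j. real n - real j / 2"]) (simp_all add: algebra_simps)

lemma expectation_num_blocks_pair_factor: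
  assumes "k \<ge> 1" "l \<ge> 1" "n \<ge> 2" "k + l \<le> n"
  shows "measure_pmf.expectation (random_ncp n) (\<lambda>P. num_blocks k P * num_blocks l P) =
    real n ^ 2 * pair_factor (k + l) n / 2 ^ (k + l + 2) +
    (if k = l then measure_pmf.expectation (random_ncp n) (num_blocks k) else 0)"
proof -
  have p: "(\<Prod>i<k + l. (real n - real i) / (2 * real n - 2 - real i)) =
      (\<Prod>i<k + l. (real n - real i) / (real n - (1 + real i / 2))) / 2 ^ (k + l)"
    by (subst prod_half_scale[where e = "\<lambda>i. real n - (1 + real i / 2)"]) (simp_all add: algebra_simps)
  show ?thesis
    unfolding expectation_num_blocks_pair[OF assms] p pair_factor_def
    using assms(3) by (simp add: field_simps power_add power2_eq_square)
qed

lemma mean_factor_expansion: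
  "first_order_expansion (mean_factor l) ((real l + 1) * (4 - real l) / 4)"
proof -
  have "first_order_expansion (mean_factor l) (\<Sum>j=0..l. real j / 2 - (real j - 1))"
    unfolding mean_factor_def[abs_def]
    by (intro first_order_expansion_prod first_order_expansion_quotient) simp
  also have "(\<Sum>j=0..l. real j / 2 - (real j - 1)) = (real l + 1) * (4 - real l) / 4"
    by (induction l) (simp_all add: field_simps)
  finally show ?thesis .
qed

lemma pair_factor_expansion:
  "first_order_expansion (pair_factor m) (1 / 2 + real m - real m * (real m - 1) / 4)"
proof -
  have "first_order_expansion (pair_factor m)
      ((0 - (-1)) + ((1 / 2 - 1) + (\<Sum>i<m. 1 + real i / 2 - real i)))"
    unfolding pair_factor_def[abs_def]
    by (intro first_order_expansion_mult first_order_expansion_prod first_order_expansion_quotient) simp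
  also have "(\<Sum>i<m. 1 + real i / 2 - real i) = real m - real m * (real m - 1) / 4"
    by (induction m) (simp_all add: field_simps)
  finally show ?thesis by (simp add: algebra_simps)
qed

text \<open>
  Covariances and variances at once: the case \<open>k = l\<close> differs only by the mean
  \<open>n / 2 ^ (l + 1) + O(1)\<close>. The coefficient of the linear term is \<open>?c\<close> of the proof, which
  simplifies to \<open>- (2 + (k - 1) * (l - 1)) / 2\<close> before division by \<open>2 ^ (k + l + 2)\<close>.
\<close>

lemma covariance_num_blocks_asymptotic:
  assumes "k \<ge> 1" "l \<ge> 1"
  shows "(\<lambda>n. pmf_covariance (random_ncp n) (num_blocks k) (num_blocks l) -
      ((if k = l then real n / 2 ^ (l + 1) else 0) -
        real n / 2 ^ (k + l + 3) * (2 + (real k - 1) * (real l - 1)))) \<in> O(\<lambda>_. 1)"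
proof -
  let ?c = "1 / 2 + real (k + l) - real (k + l) * (real (k + l) - 1) / 4
      - (real k + 1) * (4 - real k) / 4 - (real l + 1) * (4 - real l) / 4"
  let ?D = "\<lambda>n. (real n ^ 2 * pair_factor (k + l) n -
      (real n * mean_factor k n) * (real n * mean_factor l n) - ?c * real n)"
  have c: "?c = - (2 + (real k - 1) * (real l - 1)) / 2" by (simp add: field_simps)
  define p q where "p = (2::real) ^ (k + 1)" and "q = (2::real) ^ (l + 1)"
  have pq: "p > 0" "q > 0" "k = l \<Longrightarrow> p = q" by (simp_all add: p_def q_def)
  have pow: "(2::real) ^ (k + l + 3) = 2 * (p * q)" "(2::real) ^ (k + l + 2) = p * q"
    by (simp_all add: p_def q_def power_add)
  have D: "(\<lambda>n. ?D n / 2 ^ (k + l + 2)) \<in> O(\<lambda>_. 1)"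
    using first_order_expansion_product_difference[OF mean_factor_expansion[of k]
        mean_factor_expansion[of l] pair_factor_expansion[of "k + l"]] by simp
  have L: "(\<lambda>n. if k = l then (real n * mean_factor l n - real n) / 2 ^ (l + 1) else 0) \<in> O(\<lambda>_. 1)"
    using first_order_expansion_linear[OF mean_factor_expansion[of l]] by (cases "k = l") simp_all
  have "(\<lambda>n. ?D n / 2 ^ (k + l + 2) +
      (if k = l then (real n * mean_factor l n - real n) / 2 ^ (l + 1) else 0)) \<in> O(\<lambda>_. 1)"
    using D L by (rule sum_in_bigo)
  also have "?this \<longleftrightarrow> ?thesis"
  proof (rule landau_o.big.in_cong)
    show "eventually (\<lambda>n. ?D n / 2 ^ (k + l + 2) +
        (if k = l then (real n * mean_factor l n - real n) / 2 ^ (l + 1) else 0) =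
      pmf_covariance (random_ncp n) (num_blocks k) (num_blocks l) -
      ((if k = l then real n / 2 ^ (l + 1) else 0) -
        real n / 2 ^ (k + l + 3) * (2 + (real k - 1) * (real l - 1)))) sequentially"
      using eventually_ge_at_top[of "k + l + 2"]
    proof eventually_elim
      case (elim n)
      have n: "n \<ge> 1" "n \<ge> 2" "k < 2 * n" "l < 2 * n" "k + l \<le> n" using elim by auto
      show ?case
        unfolding pmf_covariance_eq[OF finite_set_random_ncp] c
          expectation_num_blocks_pair_factor[OF assms n(2,5)]
          expectation_num_blocks_factor[OF assms(1) n(1,3)]
          expectation_num_blocks_factor[OF assms(2) n(1,4)]
        unfolding pow p_def[symmetric] q_def[symmetric]
        using pq by (cases "k = l") (simp_all add: field_simps)
    qed
  qed
  finally show ?thesis .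
qed

theorem theorem2p4:
  shows "(\<forall>l n :: nat. 1 \<le> l \<longrightarrow> 1 \<le> n \<longrightarrow> l < 2 * n \<longrightarrow>
            measure_pmf.expectation (random_ncp n) (num_blocks l) =
              real n / 2 ^ (l + 1) * (\<Prod>j=0..l. 1 + (2 - real j) / (2 * real n - real j)))
       \<and> (\<forall>l :: nat. 1 \<le> l \<longrightarrow>
            (\<lambda>n. measure_pmf.variance (random_ncp n) (num_blocks l)
                   - real n / 2 ^ (2 * l + 3) * (2 ^ (l + 2) - (real l - 1)\<^sup>2 - 2))
              \<in> O[at_top](\<lambda>n. 1 :: real))
       \<and> (\<forall>k l :: nat. 1 \<le> k \<longrightarrow> 1 \<le> l \<longrightarrow> k \<noteq> l \<longrightarrow>
            (\<lambda>n. pmf_covariance (random_ncp n) (num_blocks k) (num_blocks l)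
                   - (- (real n / 2 ^ (k + l + 3) * (2 + (real k - 1) * (real l - 1)))))
              \<in> O[at_top](\<lambda>n. 1 :: real))"
proof (intro conjI allI impI)
  fix l n :: nat assume l: "1 \<le> l" and n: "1 \<le> n" "l < 2 * n"
  have "(\<Prod>j=0..l. 1 + (2 - real j) / (2 * real n - real j)) =
      (\<Prod>j=0..l. 2 * ((real n + 1 - real j) / (2 * real n - real j)))"
  proof (rule prod.cong)
    fix j assume "j \<in> {0..l}"
    then have "real j < 2 * real n" using n by (simp flip: of_nat_mult)
    then show "1 + (2 - real j) / (2 * real n - real j) =
        2 * ((real n + 1 - real j) / (2 * real n - real j))" by (simp add: field_simps)
  qed simp
  also have "\<dots> = 2 ^ (l + 1) * (\<Prod>j=0..l. (real n + 1 - real j) / (2 * real n - real j))"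
    by (simp only: prod.distrib prod_constant) simp
  finally show "measure_pmf.expectation (random_ncp n) (num_blocks l) =
      real n / 2 ^ (l + 1) * (\<Prod>j=0..l. 1 + (2 - real j) / (2 * real n - real j))"
    using expectation_num_blocks[OF l n] by simp
next
  fix l :: nat assume l: "1 \<le> l"
  have "real n / 2 ^ (2 * l + 3) * (2 ^ (l + 2) - (real l - 1)\<^sup>2 - 2) =
      real n / 2 ^ (l + 1) - real n / 2 ^ (l + l + 3) * (2 + (real l - 1) * (real l - 1))" for n
  proof -
    define p where "p = (2::real) ^ (l + 1)"
    have "p > 0" by (simp add: p_def)
    moreover have "2 * l + 3 = l + l + 3" by simp
    moreover have "(2::real) ^ (l + l + 3) = 2 * (p * p)" "(2::real) ^ (l + 2) = 2 * p"
      by (simp_all only: p_def power_add) simp_all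
    ultimately show ?thesis
      unfolding p_def[symmetric]
      by (simp only:) (simp add: field_simps power2_eq_square)
  qed
  then show "(\<lambda>n. measure_pmf.variance (random_ncp n) (num_blocks l)
      - real n / 2 ^ (2 * l + 3) * (2 ^ (l + 2) - (real l - 1)\<^sup>2 - 2)) \<in> O(\<lambda>n. 1)"
    using covariance_num_blocks_asymptotic[OF l l] by (simp only: variance_eq_pmf_covariance if_True refl)
next
  fix k l :: nat assume "1 \<le> k" "1 \<le> l" "k \<noteq> l"
  then show "(\<lambda>n. pmf_covariance (random_ncp n) (num_blocks k) (num_blocks l)
      - (- (real n / 2 ^ (k + l + 3) * (2 + (real k - 1) * (real l - 1))))) \<in> O(\<lambda>n. 1)"
    using covariance_num_blocks_asymptotic[of k l] by simp
qed

end
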